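(* Let $X$ be a real Banach space and let $\partial$ be a feasible subdifferential (on $X$). Let $f:X\to\mathbb{R}\cup\{+\infty\}$ be a proper lower semicontinuous function. If $\partial f$ is monotone, then $f$ is convex.
   Context: $X$ is a real Banach space with dual $X^*$ and duality pairing $\langle\cdot,\cdot\rangle$. For $f:X\to\mathbb{R}\cup\{+\infty\}$, $\operatorname{dom} f=\{x\in X: f(x)<+\infty\}$, and $f$ is proper if $\operatorname{dom} f\neq\emptyset$. Feasible subdifferential: a multi-valued operator $\partial$ which associates to any function $f:X\to\mathbb{R}\cup\{+\infty\}$ and any $x\in X$ a (possibly empty) subset $\partial f(x)\subset X^*$ is called a feasible subdifferential if (P1) $\partial f(x)=\partial^c f(x)$ whenever $f$ is a convex and continuous function in a neighbourhood $U$ of $x$, where $\partial^c$ is the Fenchel subdifferential, i.e. $\partial^c f(x):=\{x^*\in X^*: \langle x^*,y-x\rangle\le f(y)-f(x)\ \ \forall y\in U\}$; (P2) for $f$ lower semicontinuous and $g$ convex and continuous in a neighbourhood of $x\in\operatorname{dom} f$, one has $$0\in\partial g(x)+\limsup_{y\to x,\ f(y)\to f(x)}\partial f(y)$$ whenever $x$ is a local minimum point of $f+g$. In detail this means: there are sequences $(y_n)$ in $X$ and $y_n^*\in\partial f(y_n)$ such that $y_n\to x$ in norm, $f(y_n)\to f(x)$, and $(y_n^* )$ converges in the weak-star topology to some $y^*$ with $-y^*\in\partial g(x)$. Monotonicity: the map $\partial f:X\rightrightarrows X^*$ is identified with its graph, i.e. $(x,x^* )\in\partial f$ means $x^*\in\partial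 f(x)$. $\partial f$ is monotone if $(x_i,x_i^* )\in\partial f$, $i=1,2$, implies $\langle x_2^*-x_1^*,x_2-x_1\rangle\ge 0$. *)

theory Defs
  imports "HOL-Analysis.Analysis"
begin

type_synonym 'a dual = "'a \<Rightarrow>\<^sub>L real"

(* Functions X \<rightarrow> R \<union> {+\<infinity>} are modelled as ereal-valued functions that avoid -\<infinity>. *)
definition above_minfty :: "('a \<Rightarrow> ereal) \<Rightarrow> bool" where
  "above_minfty f \<longleftrightarrow> (\<forall>x. f x \<noteq> -\<infinity>)"

definition edom :: "('a \<Rightarrow> ereal) \<Rightarrow> 'a set" where
  "edom f = {x. f x < \<infinity>}"

definition proper_fun :: "('a \<Rightarrow> ereal) \<Rightarrow> bool" where
  "proper_fun f \<longleftrightarrow> edom f \<noteq> {}"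

definition lsc_fun :: "('a::topological_space \<Rightarrow> ereal) \<Rightarrow> bool" where
  "lsc_fun f \<longleftrightarrow> (\<forall>x. f x \<le> Liminf (at x) f)"

(* Only used for f > -\<infinity>, so the right-hand side is never \<infinity> - \<infinity>;
   0 * \<infinity> = 0 makes the cases u = 0 and v = 0 harmless. *)
definition econvex_on :: "'a::real_vector set \<Rightarrow> ('a \<Rightarrow> ereal) \<Rightarrow> bool" where
  "econvex_on S f \<longleftrightarrow> convex S \<and>
    (\<forall>x\<in>S. \<forall>y\<in>S. \<forall>u\<ge>0. \<forall>v\<ge>0. u + v = 1 \<longrightarrow>
      f (u *\<^sub>R x + v *\<^sub>R y) \<le> ereal u * f x + ereal v * f y)"

(* Continuity is meant for real values: f is required to be finite throughout the neighbourhood U. *)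
definition convex_continuous_nhd :: "'a::real_normed_vector set \<Rightarrow> 'a \<Rightarrow> ('a \<Rightarrow> ereal) \<Rightarrow> bool" where
  "convex_continuous_nhd U x f \<longleftrightarrow>
     open U \<and> x \<in> U \<and> (\<forall>y\<in>U. \<bar>f y\<bar> \<noteq> \<infinity>) \<and> econvex_on U f \<and> continuous_on U f"

definition fenchel_subdiff ::
  "'a::real_normed_vector set \<Rightarrow> ('a \<Rightarrow> ereal) \<Rightarrow> 'a \<Rightarrow> 'a dual set" where
  "fenchel_subdiff U f x =
     {xs. \<forall>y\<in>U. ereal (blinfun_apply xs (y - x)) \<le> f y - f x}"

definition local_min_point :: "('a::topological_space \<Rightarrow> ereal) \<Rightarrow> 'a \<Rightarrow> bool" where
  "local_min_point h x \<longleftrightarrow> eventually (\<lambda>y. h x \<le> h y) (nhds x)"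

(* Sequential outer limit of D f at x along f-attentive convergence. On the dual space the
   strong operator topology (pointwise convergence) is exactly the weak-star topology. *)
definition limsup_subdiff ::
  "(('a::real_normed_vector \<Rightarrow> ereal) \<Rightarrow> 'a \<Rightarrow> 'a dual set) \<Rightarrow> ('a \<Rightarrow> ereal) \<Rightarrow> 'a \<Rightarrow> 'a dual set"
  where
  "limsup_subdiff D f x =
     {ystar. \<exists>(y :: nat \<Rightarrow> 'a) (ys :: nat \<Rightarrow> 'a dual).
        (\<forall>n. ys n \<in> D f (y n)) \<and> y \<longlonglongrightarrow> x \<and> (\<lambda>n. f (y n)) \<longlonglongrightarrow> f x \<and>
        limitin strong_operator_topology ys ystar sequentially}"

definition feasible_subdifferential ::
  "(('a::real_normed_vector \<Rightarrow> ereal) \<Rightarrow> 'a \<Rightarrow> 'a dual set) \<Rightarrow> bool" where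
  "feasible_subdifferential D \<longleftrightarrow>
     (\<forall>f U x. above_minfty f \<and> convex_continuous_nhd U x f \<longrightarrow> D f x = fenchel_subdiff U f x) \<and>
     (\<forall>f g x. above_minfty f \<and> above_minfty g \<and> lsc_fun f \<and> x \<in> edom f \<and>
        (\<exists>U. convex_continuous_nhd U x g) \<and> local_min_point (\<lambda>y. f y + g y) x \<longrightarrow>
        (\<exists>xs \<in> D g x. \<exists>ystar \<in> limsup_subdiff D f x. 0 = xs + ystar))"

definition operator_graph :: "('a::real_normed_vector \<Rightarrow> 'a dual set) \<Rightarrow> ('a \<times> 'a dual) set" where
  "operator_graph T = {(x, xs). xs \<in> T x}"

definition monotone_operator :: "('a::real_normed_vector \<Rightarrow> 'a dual set) \<Rightarrow> bool" where
  "monotone_operator T \<longleftrightarrow>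
     (\<forall>x1 xs1 x2 xs2. (x1, xs1) \<in> operator_graph T \<and> (x2, xs2) \<in> operator_graph T \<longrightarrow>
        blinfun_apply (xs2 - xs1) (x2 - x1) \<ge> 0)"

end

theory Submission
  imports Defs
begin

text \<open>
  The key is to minimise \<open>f - l + 2 * K * dist z\<close>, for a continuous linear \<open>l\<close>, near a
  segment from a point \<open>a\<close> of the domain to \<open>z\<close>, up to an Ekeland perturbation of slope
  \<open>K\<close>. This gives a point \<open>w\<close> and a limiting subgradient \<open>w\<^sup>*\<close> with
  \<open>\<langle>w\<^sup>* - l, z - w\<rangle> \<ge> K * dist w z\<close>.

  Let \<open>u\<^sup>*\<close> be a subgradient at \<open>u\<close>. If \<open>f a - \<langle>u\<^sup>*, a\<rangle> < f u - \<langle>u\<^sup>*, u\<rangle>\<close> for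
  some \<open>a\<close>, then \<open>l = u\<^sup>*\<close>, \<open>z = u\<close> and a small \<open>K\<close> yield \<open>w \<noteq> u\<close> violating
  monotonicity. So every subgradient is a global affine minorant.

  If \<open>f z > s * f a + t * f b\<close> at \<open>z = s *\<^sub>R a + t *\<^sub>R b\<close>, then \<open>l = 0\<close> and a large \<open>K\<close> yield
  \<open>f w + \<langle>w\<^sup>*, z - w\<rangle> > s * f a + t * f b\<close>: near \<open>z\<close> by lower semicontinuity, away from \<open>z\<close>
  by the term \<open>K * dist w z\<close>. This contradicts the affine minorants at \<open>a\<close> and \<open>b\<close>.
  The Banach-Steinhaus theorem allows passing to the weak-star limit along moving points.
\<close>

section \<open>Pointwise convergent sequences of operators\<close>

text \<open>By Baire, one of the closed sets \<open>E k\<close> covering the space contains a ball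
  \<open>cball x e\<close>. A vector of norm \<open>e\<close> is the difference of two points of
  that ball, so every \<open>T n\<close> is bounded on it by \<open>2 * k\<close>.\<close>

lemma uniform_boundedness_sequence:
  fixes T :: "nat \<Rightarrow> 'a::banach \<Rightarrow>\<^sub>L 'b::real_normed_vector"
  assumes "\<And>x. bounded (range (\<lambda>n. T n x))"
  shows "bounded (range T)"
proof -
  define E where "E k = (\<Inter>n. {x. norm (T n x) \<le> real k})" for k
  have closed_E: "closed (E k)" for k
    unfolding E_def by (intro closed_INT ballI closed_Collect_le continuous_intros)
  have "x \<in> (\<Union>k. E k)" for x
  proof -
    obtain B where "\<And>n. norm (T n x) \<le> B"
      using assms[of x] by (auto simp: bounded_iff)
    moreover obtain k where "B \<le> real k" using real_arch_simple by blast
    ultimately show ?thesis unfolding E_def by (auto intro: order_trans)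
  qed
  then have cover: "(\<Union>k. E k) = UNIV" by blast
  have "\<exists>k. interior (E k) \<noteq> {}"
  proof (rule ccontr)
    assume "\<not> ?thesis"
    then have "euclidean interior_of (\<Union>(range E)) = {}"
      using closed_E by (intro Baire_category_alt) (auto simp: completely_metrizable_space_euclidean)
    then show False by (simp add: cover)
  qed
  then obtain k x where "x \<in> interior (E k)" by blast
  then obtain e where e: "e > 0" "cball x e \<subseteq> E k"
    unfolding mem_interior_cball by blast
  have "norm (T n) \<le> 2 * real k / e" for n
  proof (rule norm_blinfun_bound)
    fix h
    show "norm (T n h) \<le> 2 * real k / e * norm h"
    proof (cases "h = 0")
      case False
      define u where "u = (e / norm h) *\<^sub>R h"
      have "x \<in> E k" "x + u \<in> E k"
        using e False by (auto intro!: subsetD[OF e(2)] simp: u_def dist_norm)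
      then have "norm (T n x) \<le> k" "norm (T n (x + u)) \<le> k" unfolding E_def by auto
      moreover have "T n u = T n (x + u) - T n x" by (simp add: blinfun.add_right)
      ultimately have "norm (T n u) \<le> 2 * real k"
        using norm_triangle_ineq4[of "T n (x + u)" "T n x"] by simp
      moreover have "norm (T n u) = e / norm h * norm (T n h)"
        using e by (simp add: u_def blinfun.scaleR_right)
      ultimately show ?thesis using e False by (simp add: field_simps)
    qed simp
  qed (use e in simp)
  then show ?thesis unfolding bounded_iff by blast
qed

text \<open>In \<open>T n (x n) = T n a + T n (x n - a)\<close> the second term vanishes, since
  Banach-Steinhaus bounds the operator norms.\<close>

lemma tendsto_blinfun_apply_pointwise:
  fixes T :: "nat \<Rightarrow> 'a::banach \<Rightarrow>\<^sub>L 'b::real_normed_vector"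
  assumes T: "\<And>x. (\<lambda>n. T n x) \<longlonglongrightarrow> L x" and x: "x \<longlonglongrightarrow> a"
  shows "(\<lambda>n. T n (x n)) \<longlonglongrightarrow> L a"
proof -
  have "bounded (range T)"
    using T by (intro uniform_boundedness_sequence convergent_imp_bounded)
  then obtain B where B: "norm (T n) \<le> B" for n by (auto simp: bounded_iff)
  have "(\<lambda>n. T n (x n - a)) \<longlonglongrightarrow> 0"
  proof (rule Lim_null_comparison)
    have "norm (T n (x n - a)) \<le> B * norm (x n - a)" for n
      by (rule order_trans[OF norm_blinfun mult_right_mono[OF B norm_ge_zero]])
    then show "\<forall>\<^sub>F n in sequentially. norm (T n (x n - a)) \<le> B * norm (x n - a)" by simp
    show "(\<lambda>n. B * norm (x n - a)) \<longlonglongrightarrow> 0"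
      using x by (intro tendsto_mult_right_zero tendsto_norm_zero LIM_zero)
  qed
  from tendsto_add[OF T[of a] this] show ?thesis
    by (simp add: blinfun.diff_right)
qed

section \<open>Lower semicontinuous functions\<close>

lemma lsc_fun_iff:
  "lsc_fun f \<longleftrightarrow> (\<forall>x r. r < f x \<longrightarrow> (\<forall>\<^sub>F y in nhds x. r < f y))"
  unfolding lsc_fun_def le_Liminf_iff by (auto simp: eventually_nhds_conv_at)

lemma lsc_funD: "lsc_fun f \<Longrightarrow> r < f x \<Longrightarrow> \<forall>\<^sub>F y in nhds x. r < f y"
  by (simp add: lsc_fun_iff)

lemma lsc_fun_open_superlevel:
  assumes "lsc_fun f" shows "open {x. r < f x}"
proof (subst open_subopen, intro ballI)
  fix x assume "x \<in> {x. r < f x}"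
  then have "\<forall>\<^sub>F y in nhds x. r < f y" using lsc_funD[OF assms] by simp
  then show "\<exists>T. open T \<and> x \<in> T \<and> T \<subseteq> {x. r < f x}" unfolding eventually_nhds by blast
qed

lemma lsc_fun_closed_sublevel:
  assumes "lsc_fun f" shows "closed {x. f x \<le> r}"
proof -
  have "{x. f x \<le> r} = - {x. r < f x}" by auto
  then show ?thesis using lsc_fun_open_superlevel[OF assms] by (simp add: closed_def)
qed

lemma lsc_fun_add_continuous:
  assumes f: "lsc_fun f" and g: "continuous_on UNIV g"
  shows "lsc_fun (\<lambda>x. f x + ereal (g x))"
  unfolding lsc_fun_iff
proof (intro allI impI)
  fix x r assume r: "r < f x + ereal (g x)"
  show "\<forall>\<^sub>F y in nhds x. r < f y + ereal (g y)"
  proof (cases r)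
    case (real r')
    then have "ereal (r' - g x) < f x" using r by (cases "f x") auto
    \<comment> \<open>The intermediate \<open>s\<close> splits the sum into the separate open
      conditions \<open>s < f y\<close> and \<open>r' - s < g y\<close>.\<close>
    then obtain s where s: "ereal (r' - g x) < ereal s" "ereal s < f x"
      using ereal_dense2 by blast
    have "open {y. r' - s < g y}"
      by (intro open_Collect_less continuous_on_const g)
    then have "\<forall>\<^sub>F y in nhds x. r' - s < g y"
      using eventually_nhds_in_open[of "{y. r' - s < g y}" x] s(1) by simp
    moreover have "\<forall>\<^sub>F y in nhds x. ereal s < f y" using lsc_funD[OF f s(2)] .
    ultimately show ?thesis
    proof eventually_elim
      case (elim y)
      then show ?case using real by (cases "f y") auto
    qed
  next
    case MInf
    then have "- \<infinity> < f x" using r by (cases "f x") auto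
    from lsc_funD[OF f this] show ?thesis
      by eventually_elim (simp add: MInf ereal_less_eq less_le)
  qed (use r in simp)
qed

lemma infdist_attains_inf_compact:
  fixes S :: "'a::metric_space set"
  assumes "compact S" "S \<noteq> {}"
  obtains x where "x \<in> S" "infdist y S = dist y x"
proof -
  obtain x where x: "x \<in> S" "\<And>z. z \<in> S \<Longrightarrow> dist y x \<le> dist y z"
    using continuous_attains_inf[OF assms continuous_on_dist[OF continuous_on_const continuous_on_id]]
    by blast
  then have "dist y x \<le> infdist y S"
    using assms(2) by (auto simp: infdist_def intro: cINF_greatest)
  with x(1) show thesis by (intro that antisym infdist_le)
qed

text \<open>The open superlevel sets \<open>V n\<close> increase and cover the space; by compactness
  a single one contains \<open>S\<close> together with a uniform neighbourhood.\<close>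

lemma lsc_fun_bounded_below_near_compact:
  fixes f :: "'a::metric_space \<Rightarrow> ereal"
  assumes "lsc_fun f" "above_minfty f" "compact S" "S \<noteq> {}"
  obtains \<delta> m where "\<delta> > 0" "\<And>y. infdist y S \<le> \<delta> \<Longrightarrow> ereal m \<le> f y"
proof -
  define V where "V n = {x. ereal (- real n) < f x}" for n :: nat
  have "x \<in> (\<Union>n. V n)" for x
  proof (cases "f x")
    case (real r)
    obtain n where "- r < real n" using reals_Archimedean2 by blast
    then show ?thesis using real by (auto simp: V_def intro!: exI[of _ n])
  qed (use assms(2) in \<open>auto simp: V_def above_minfty_def\<close>)
  then have cover: "S \<subseteq> (\<Union>n\<in>UNIV. V n)" by blast
  have open_V: "open (V n)" for n
    unfolding V_def by (rule lsc_fun_open_superlevel[OF assms(1)])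
  obtain N where N: "finite N" "S \<subseteq> (\<Union>n\<in>N. V n)"
    by (rule compactE_image[OF assms(3) open_V cover])
  define k where "k = Max (insert 0 N)"
  have "V n \<subseteq> V k" if "n \<in> N" for n
  proof -
    have "n \<le> k" using N that by (simp add: k_def)
    then have "ereal (- real k) \<le> ereal (- real n)" by simp
    then show ?thesis unfolding V_def by (auto intro: le_less_trans simp del: ereal_less_eq)
  qed
  then have "S \<subseteq> V k" using N by blast
  then obtain e where e: "e > 0" "(\<Union>x\<in>S. ball x e) \<subseteq> V k"
    by (rule compact_subset_open_imp_ball_epsilon_subset[OF assms(3) open_V])
  show thesis
  proof (rule that[of "e / 2" "- real k"])
    fix y assume y: "infdist y S \<le> e / 2"
    obtain x where "x \<in> S" "infdist y S = dist y x"
      by (rule infdist_attains_inf_compact[OF assms(3,4)])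
    then have "y \<in> ball x e" using y e(1) by (simp add: dist_commute)
    then have "y \<in> V k" using \<open>x \<in> S\<close> e(2) by blast
    then show "ereal (- real k) \<le> f y" by (simp add: V_def)
  qed (use e in simp)
qed

section \<open>Ekeland's variational principle\<close>

text \<open>\<open>S x\<close> holds the points \<open>y\<close> of \<open>C\<close> at which \<phi>
  has dropped from its value at \<open>x\<close> by at least \<open>\<epsilon> * dist x y\<close>.
  Successive almost minimal choices give nested closed sets of vanishing diameter, and their common
  point \<open>w\<close> has nothing but itself in \<open>S w\<close>.\<close>

lemma ekeland_variational_principle:
  fixes \<phi> :: "'a::complete_space \<Rightarrow> ereal"
  assumes lsc: "lsc_fun \<phi>" and C: "closed C" and low: "\<And>y. y \<in> C \<Longrightarrow> ereal m \<le> \<phi> y"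
    and a: "a \<in> C" "\<phi> a < \<infinity>" and eps: "\<epsilon> > 0"
  obtains w where "w \<in> C" "\<phi> w + ereal (\<epsilon> * dist a w) \<le> \<phi> a"
    "\<And>y. y \<in> C \<Longrightarrow> \<phi> w \<le> \<phi> y + ereal (\<epsilon> * dist w y)"
proof -
  define S where "S x = C \<inter> {y. \<phi> y + ereal (\<epsilon> * dist x y) \<le> \<phi> x}" for x
  have closed_S: "closed (S x)" for x
    unfolding S_def
    by (intro closed_Int C lsc_fun_closed_sublevel lsc_fun_add_continuous lsc continuous_intros)
  have S_self: "x \<in> S x" if "x \<in> C" for x using that by (simp add: S_def)
  have S_C: "S x \<subseteq> C" for x by (auto simp: S_def)
  have S_mono: "S y \<subseteq> S x" if "y \<in> S x" for x y
  proof
    fix z assume z: "z \<in> S y"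
    have "\<phi> z + ereal (\<epsilon> * dist x z) \<le> \<phi> z + ereal (\<epsilon> * dist y z) + ereal (\<epsilon> * dist x y)"
    proof -
      have "\<epsilon> * dist x z \<le> \<epsilon> * (dist y z + dist x y)"
        using eps dist_triangle[of x z y] by (intro mult_left_mono) auto
      then show ?thesis by (cases "\<phi> z") (auto simp: distrib_left)
    qed
    also have "\<dots> \<le> \<phi> y + ereal (\<epsilon> * dist x y)"
      using z by (intro add_right_mono) (simp add: S_def)
    also have "\<dots> \<le> \<phi> x" using that by (simp add: S_def)
    finally show "z \<in> S x" using z by (simp add: S_def)
  qed
  define good where "good x \<longleftrightarrow> x \<in> C \<and> \<phi> x < \<infinity>" for x
  have step: "\<exists>y. good y \<and> y \<in> S x \<and> (\<forall>z\<in>S x. \<phi> y \<le> \<phi> z + ereal ((1/2)^n))"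
    if x: "good x" for x and n :: nat
  proof -
    let ?I = "INF y\<in>S x. \<phi> y"
    have "ereal m \<le> ?I" using low S_C by (intro INF_greatest) auto
    moreover have "?I \<le> \<phi> x" using S_self x by (intro INF_lower) (auto simp: good_def)
    ultimately have I: "\<bar>?I\<bar> \<noteq> \<infinity>" using x by (auto simp: good_def)
    then have "?I < ?I + ereal ((1/2)^n)" by (cases ?I) auto
    then obtain y where y: "y \<in> S x" "\<phi> y < ?I + ereal ((1/2)^n)"
      unfolding INF_less_iff by blast
    have "\<phi> y \<le> \<phi> z + ereal ((1/2)^n)" if "z \<in> S x" for z
      using y(2) add_right_mono[OF INF_lower[OF that, of \<phi>], of "ereal ((1/2)^n)"] by simp
    moreover have "good y" using y S_C[of x] I by (cases ?I) (auto simp: good_def)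
    ultimately show ?thesis using y by blast
  qed
  have "\<exists>x. \<forall>n. (good (x n) \<and> (n = 0 \<longrightarrow> x n = a)) \<and>
      (x (Suc n) \<in> S (x n) \<and> (\<forall>z\<in>S (x n). \<phi> (x (Suc n)) \<le> \<phi> z + ereal ((1/2)^n)))"
    by (rule dependent_nat_choice) (use a step in \<open>auto simp: good_def\<close>)
  then obtain x where good: "good (x n)" and x0: "x 0 = a" and x_S: "x (Suc n) \<in> S (x n)"
    and x_min: "z \<in> S (x n) \<Longrightarrow> \<phi> (x (Suc n)) \<le> \<phi> z + ereal ((1/2)^n)" for n z
    by blast
  \<comment> \<open>On \<open>S (x n)\<close> the values fall below that at \<open>x (Suc n)\<close>
    by at most \<open>(1/2)^n\<close>, yet membership of \<open>z\<close> demands a drop of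
    \<open>\<epsilon> * dist (x (Suc n)) z\<close>.\<close>
  have small: "dist (x (Suc n)) z \<le> (1/2)^n / \<epsilon>" if z: "z \<in> S (x (Suc n))" for n z
  proof -
    have "z \<in> S (x n)" using S_mono[OF x_S] z by blast
    from x_min[OF this] z have "\<phi> z + ereal (\<epsilon> * dist (x (Suc n)) z) \<le> \<phi> z + ereal ((1/2)^n)"
      by (auto simp: S_def)
    moreover have "ereal m \<le> \<phi> z" "\<phi> z < \<infinity>"
      using z good[of "Suc n"] low by (auto simp: S_def good_def)
    ultimately have "\<epsilon> * dist (x (Suc n)) z \<le> (1/2)^n" by (cases "\<phi> z") auto
    then show ?thesis using eps by (simp add: field_simps)
  qed
  have small_eventually: "\<exists>n. (1/2)^n / \<epsilon> < e" if "e > 0" for e :: real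
  proof -
    obtain n where "(1/2::real)^n < e * \<epsilon>"
      using real_arch_pow_inv[of "e * \<epsilon>" "1/2"] mult_pos_pos[OF \<open>e > 0\<close> eps] by auto
    then show ?thesis using eps by (auto simp: field_simps)
  qed
  have "\<exists>w. \<Inter>(range (\<lambda>n. S (x n))) = {w}"
  proof (rule decreasing_closed_nest_sing)
    show "S (x n) \<noteq> {}" for n using good S_self by (auto simp: good_def)
    show "S (x n) \<subseteq> S (x k)" if "k \<le> n" for k n
      using that S_mono[OF x_S] by (rule lift_Suc_antimono_le[rotated])
    fix e :: real assume "e > 0"
    then obtain n where n: "(1/2)^n / \<epsilon> < e / 2" using small_eventually[of "e/2"] by auto
    have "dist y z < e" if "y \<in> S (x (Suc n))" "z \<in> S (x (Suc n))" for y z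
      using small[OF that(1)] small[OF that(2)] n dist_triangle3[of y z "x (Suc n)"] by linarith
    then show "\<exists>n. \<forall>y\<in>S (x n). \<forall>z\<in>S (x n). dist y z < e" by blast
  qed (rule closed_S)
  then obtain w where w: "\<Inter>(range (\<lambda>n. S (x n))) = {w}" by blast
  then have w_S: "w \<in> S (x n)" for n by blast
  have S_w: "S w \<subseteq> {w}" using S_mono[OF w_S] w by blast
  show thesis
  proof
    show "w \<in> C" using w_S S_C by blast
    show "\<phi> w + ereal (\<epsilon> * dist a w) \<le> \<phi> a" using w_S[of 0] by (simp add: S_def x0)
    fix y assume y: "y \<in> C"
    show "\<phi> w \<le> \<phi> y + ereal (\<epsilon> * dist w y)"
    proof (rule ccontr)
      assume "\<not> ?thesis"
      \<comment> \<open>A violating \<open>y\<close> lies in \<open>S w\<close>, hence equals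
        \<open>w\<close>, where the strict inequality is absurd.\<close>
      then have "\<phi> y + ereal (\<epsilon> * dist w y) < \<phi> w" "y \<in> S w" using y by (auto simp: S_def)
      then show False using S_w by auto
    qed
  qed
qed

section \<open>Convex functions and distances\<close>

text \<open>Compactness provides nearest points; their convex combination stays in \<open>S\<close>,
  and the triangle inequality finishes.\<close>

lemma convex_on_infdist:
  fixes S :: "'a::real_normed_vector set"
  assumes S: "convex S" "compact S" "S \<noteq> {}"
  shows "convex_on UNIV (\<lambda>x. infdist x S)"
proof (rule convex_onI)
  fix t :: real and x y :: 'a assume t: "0 < t" "t < 1"
  obtain p where p: "p \<in> S" "infdist x S = dist x p"
    by (rule infdist_attains_inf_compact[OF S(2,3)])
  obtain q where q: "q \<in> S" "infdist y S = dist y q"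
    by (rule infdist_attains_inf_compact[OF S(2,3)])
  have "(1 - t) *\<^sub>R p + t *\<^sub>R q \<in> S"
    using S(1) p q t by (simp add: convex_alt)
  then have "infdist ((1 - t) *\<^sub>R x + t *\<^sub>R y) S
      \<le> dist ((1 - t) *\<^sub>R x + t *\<^sub>R y) ((1 - t) *\<^sub>R p + t *\<^sub>R q)"
    by (rule infdist_le)
  also have "\<dots> = norm ((1 - t) *\<^sub>R (x - p) + t *\<^sub>R (y - q))"
    by (simp add: dist_norm algebra_simps)
  also have "\<dots> \<le> (1 - t) * norm (x - p) + t * norm (y - q)"
    using t by (intro norm_triangle_le) simp
  finally show "infdist ((1 - t) *\<^sub>R x + t *\<^sub>R y) S \<le> (1 - t) * infdist x S + t * infdist y S"
    by (simp add: p q dist_norm)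
qed simp

lemma convex_continuous_nhd_ereal:
  assumes "convex_on UNIV G" "continuous_on UNIV G"
  shows "convex_continuous_nhd UNIV x (\<lambda>y. ereal (G y))"
  using assms
  by (auto simp: convex_continuous_nhd_def econvex_on_def convex_on_def intro!: continuous_intros)

section \<open>Monotone feasible subdifferentials\<close>

text \<open>(P2) gives the limit \<open>ystar\<close>, and (P1) turns \<open>- ystar\<close> into a
  Fenchel subgradient of \<open>G\<close> on the whole space. Banach-Steinhaus enters because the
  arguments \<open>z - y n\<close> move with \<open>n\<close>.\<close>

lemma feasible_subdifferential_limit:
  fixes D :: "('a::banach \<Rightarrow> ereal) \<Rightarrow> 'a \<Rightarrow> 'a dual set"
  assumes D: "feasible_subdifferential D" and f: "above_minfty f" "lsc_fun f" "w \<in> edom f"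
    and G: "convex_on UNIV G" "continuous_on UNIV G"
    and min: "local_min_point (\<lambda>y. f y + ereal (G y)) w"
  obtains y :: "nat \<Rightarrow> 'a" and ys :: "nat \<Rightarrow> 'a dual" and ystar :: "'a dual"
  where "\<And>n. ys n \<in> D f (y n)" "y \<longlonglongrightarrow> w" "(\<lambda>n. f (y n)) \<longlonglongrightarrow> f w"
    "\<And>z. (\<lambda>n. ys n (z - y n)) \<longlonglongrightarrow> ystar (z - w)"
    "\<And>z. G w - G z \<le> ystar (z - w)"
proof -
  let ?g = "\<lambda>y. ereal (G y)"
  have cc: "convex_continuous_nhd UNIV w ?g"
    using G by (rule convex_continuous_nhd_ereal)
  have above: "above_minfty ?g" by (simp add: above_minfty_def)
  from D f above cc min obtain xs ystar
    where xs: "xs \<in> D ?g w" and ystar: "ystar \<in> limsup_subdiff D f w" and sum: "0 = xs + ystar"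
    unfolding feasible_subdifferential_def by blast
  have "D ?g w = fenchel_subdiff UNIV ?g w"
    using D above cc unfolding feasible_subdifferential_def by blast
  with xs have xs_le: "xs (z - w) \<le> G z - G w" for z
    by (simp add: fenchel_subdiff_def)
  have "ystar = - xs" using sum by (simp add: eq_neg_iff_add_eq_0 add.commute)
  then have *: "G w - G z \<le> ystar (z - w)" for z
    using xs_le[of z] by (simp add: blinfun.minus_left)
  from ystar obtain y :: "nat \<Rightarrow> 'a" and ys :: "nat \<Rightarrow> 'a dual"
    where y: "\<And>n. ys n \<in> D f (y n)" "y \<longlonglongrightarrow> w" "(\<lambda>n. f (y n)) \<longlonglongrightarrow> f w"
      and lim: "limitin strong_operator_topology ys ystar sequentially"
    unfolding limsup_subdiff_def by blast
  have "(\<lambda>n. ys n x) \<longlonglongrightarrow> ystar x" for x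
    using continuous_map_limit[OF strong_operator_topology_continuous_evaluation[of x] lim]
    by (simp add: o_def)
  then have "(\<lambda>n. ys n (z - y n)) \<longlonglongrightarrow> ystar (z - w)" for z
    by (rule tendsto_blinfun_apply_pointwise) (intro tendsto_intros y)
  then show thesis by (rule that[OF y _ *])
qed

text \<open>
  Subgradients near \<open>w\<close> point towards \<open>z\<close> because of the cone \<open>2 * K * dist w z\<close> added to
  \<open>f - l\<close>. The multiple of the distance to the segment, which vanishes at both end points and so
  does not disturb the estimates, keeps the Ekeland point in the region where \<open>f - l\<close> is bounded below.
\<close>

lemma subgradients_towards_point:
  fixes D :: "('a::banach \<Rightarrow> ereal) \<Rightarrow> 'a \<Rightarrow> 'a dual set" and l :: "'a dual"
  assumes D: "feasible_subdifferential D" and f: "above_minfty f" "lsc_fun f" and a: "a \<in> edom f"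
    and K: "K > 0" and \<delta>: "\<delta> > 0"
    and low: "\<And>y. infdist y (closed_segment a z) \<le> \<delta> \<Longrightarrow> ereal m \<le> f y + ereal (- l y)"
  obtains w and ys :: "nat \<Rightarrow> 'a dual" and y :: "nat \<Rightarrow> 'a" and L
  where "infdist w (closed_segment a z) \<le> \<delta>"
    "f w + ereal (K * dist w z - l w) \<le> f a + ereal (2 * K * dist a z - l a)"
    "\<And>n. ys n \<in> D f (y n)" "y \<longlonglongrightarrow> w" "(\<lambda>n. f (y n)) \<longlonglongrightarrow> f w"
    "(\<lambda>n. ys n (z - y n)) \<longlonglongrightarrow> L" "l (z - w) + K * dist w z \<le> L"
proof -
  let ?S = "closed_segment a z"
  let ?d = "\<lambda>x. infdist x ?S"
  obtain \<alpha> where \<alpha>: "f a = ereal \<alpha>"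
    using a f(1) by (cases "f a") (auto simp: edom_def above_minfty_def)
  \<comment> \<open>\<open>v\<close> is the value at \<open>a\<close> of the function \<phi> below.
    The weight \<open>n\<close> makes the penalty at distance \<delta> from the segment exceed
    \<open>v - m\<close>.\<close>
  define v where "v = \<alpha> + 2 * K * dist a z - l a"
  define n where "n = (\<bar>v - m\<bar> + 1) / \<delta>"
  have n: "n > 0" "n * \<delta> > v - m" using \<delta> by (auto simp: n_def)
  define G where "G x = - l x + 2 * K * dist z x + n * ?d x" for x
  have "convex_on UNIV (\<lambda>x. - l x)"
    by (auto simp: convex_on_def blinfun.add_right blinfun.scaleR_right)
  then have "convex_on UNIV G"
    unfolding G_def using K n
    by (intro convex_on_add convex_on_cmul convex_on_dist convex_on_infdist) auto
  moreover have "continuous_on UNIV G" unfolding G_def by (intro continuous_intros)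
  ultimately have G: "convex_on UNIV G" "continuous_on UNIV G" by blast+
  define \<phi> where "\<phi> x = f x + ereal (G x)" for x
  have lsc_\<phi>: "lsc_fun \<phi>" unfolding \<phi>_def by (rule lsc_fun_add_continuous[OF f(2) G(2)])
  have closed: "closed {x. ?d x \<le> \<delta>}" by (intro closed_Collect_le continuous_intros)
  have low_\<phi>: "ereal m \<le> \<phi> y" if "y \<in> {x. ?d x \<le> \<delta>}" for y
  proof -
    have "0 \<le> 2 * K * dist z y + n * ?d y" using K n by (simp add: infdist_nonneg)
    then show ?thesis
      using low[of y] that by (cases "f y") (auto simp: \<phi>_def G_def)
  qed
  have \<phi>_a: "\<phi> a = ereal v" by (simp add: \<phi>_def G_def v_def \<alpha> dist_commute)
  obtain w where w: "?d w \<le> \<delta>" and w_a: "\<phi> w + ereal (K * dist a w) \<le> \<phi> a"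
    and w_min: "\<And>y. ?d y \<le> \<delta> \<Longrightarrow> \<phi> w \<le> \<phi> y + ereal (K * dist w y)"
    by (rule ekeland_variational_principle[OF lsc_\<phi> closed low_\<phi> _ _ K, of a])
      (use \<delta> \<phi>_a in \<open>auto\<close>)
  have "f w \<noteq> \<infinity>" using w_a unfolding \<phi>_a by (auto simp: \<phi>_def)
  then obtain \<gamma> where \<gamma>: "f w = ereal \<gamma>"
    using f(1) by (cases "f w") (auto simp: above_minfty_def)
  have w_v: "\<gamma> + G w + K * dist a w \<le> v" using w_a unfolding \<phi>_a by (simp add: \<phi>_def \<gamma>)
  have "m \<le> \<gamma> - l w" using low[OF w] by (simp add: \<gamma>)
  moreover have nonneg: "0 \<le> K * dist a w" "0 \<le> K * dist w z" "0 \<le> n * ?d w"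
    using K n by (auto simp: infdist_nonneg)
  \<comment> \<open>\<open>f - l\<close> is at least \<open>m\<close> at \<open>w\<close>, while the
    value of \<phi> there is at most \<open>v\<close>. Hence \<open>w\<close> is interior to the
    constraint set, and constrained minimality becomes a local minimum.\<close>
  ultimately have "n * ?d w < n * \<delta>"
    using w_v n(2) by (simp add: G_def dist_commute)
  then have "?d w < \<delta>" using n(1) by simp
  moreover have "open {y. ?d y < \<delta>}" by (intro open_Collect_less continuous_intros)
  ultimately have "\<forall>\<^sub>F y in nhds w. ?d y < \<delta>"
    using eventually_nhds_in_open[of "{y. ?d y < \<delta>}" w] by simp
  then have min: "local_min_point (\<lambda>y. f y + ereal (G y + K * dist w y)) w"
    unfolding local_min_point_def
  proof eventually_elim
    case (elim y)
    then show ?case using w_min[of y] by (cases "f y") (auto simp: \<phi>_def \<gamma>)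
  qed
  have G': "convex_on UNIV (\<lambda>y. G y + K * dist w y)"
    using K by (intro convex_on_add convex_on_cmul convex_on_dist G) auto
  have cont_G': "continuous_on UNIV (\<lambda>y. G y + K * dist w y)"
    by (intro continuous_intros G)
  have w_dom: "w \<in> edom f" by (simp add: edom_def \<gamma>)
  obtain y :: "nat \<Rightarrow> 'a" and ys :: "nat \<Rightarrow> 'a dual" and ystar :: "'a dual"
    where y: "\<And>n. ys n \<in> D f (y n)" "y \<longlonglongrightarrow> w" "(\<lambda>n. f (y n)) \<longlonglongrightarrow> f w"
      "\<And>z. (\<lambda>n. ys n (z - y n)) \<longlonglongrightarrow> ystar (z - w)"
    and ystar: "\<And>z. G w + K * dist w w - (G z + K * dist w z) \<le> ystar (z - w)"
    by (rule feasible_subdifferential_limit[OF D f w_dom G' cont_G' min]) (rule that)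
  show thesis
  proof (rule that[OF w _ y(1-3) y(4)[of z]])
    show "f w + ereal (K * dist w z - l w) \<le> f a + ereal (2 * K * dist a z - l a)"
      using w_v nonneg by (simp add: \<gamma> \<alpha> G_def v_def dist_commute)
    \<comment> \<open>Moving from \<open>w\<close> to \<open>z\<close> gains
      \<open>2 * K * dist w z\<close> from the cone and loses \<open>K * dist w z\<close> to the
      Ekeland perturbation; the segment penalty vanishes at \<open>z\<close>.\<close>
    show "l (z - w) + K * dist w z \<le> ystar (z - w)"
      using ystar[of z] nonneg by (simp add: G_def blinfun.diff_right dist_commute)
  qed
qed

lemma monotone_subdifferential_affine_minorant:
  fixes D :: "('a::banach \<Rightarrow> ereal) \<Rightarrow> 'a \<Rightarrow> 'a dual set" and us :: "'a dual"
  assumes D: "feasible_subdifferential D" and f: "above_minfty f" "lsc_fun f"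
    and mono: "monotone_operator (D f)" and us: "us \<in> D f u"
  shows "f u + ereal (us (a - u)) \<le> f a"
proof (rule ccontr)
  assume "\<not> ?thesis"
  then have less: "f a < f u + ereal (us (a - u))" by simp
  then have a: "a \<in> edom f" by (auto simp: edom_def)
  obtain \<alpha> where \<alpha>: "f a = ereal \<alpha>"
    using a f(1) by (cases "f a") (auto simp: edom_def above_minfty_def)
  obtain K where K: "K > 0" "ereal (\<alpha> + 2 * K * dist a u - us a) < f u + ereal (- us u)"
  proof (cases "f u")
    case (real \<beta>)
    define gap where "gap = \<beta> - us u - (\<alpha> - us a)"
    have gap: "gap > 0" using less by (simp add: real \<alpha> gap_def blinfun.diff_right)
    \<comment> \<open>This keeps \<open>2 * K * dist a u\<close> strictly below \<open>gap\<close>;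
      the added 1 also avoids a zero denominator.\<close>
    define K where "K = gap / (2 * (dist a u + 1))"
    have pos: "dist a u + 1 > 0" by (simp add: add_nonneg_pos)
    then have "2 * K * (dist a u + 1) = gap" unfolding K_def by (simp add: field_simps)
    moreover have "K > 0" using gap pos by (simp add: K_def)
    ultimately show ?thesis using that[of K] by (simp add: real gap_def algebra_simps)
  next
    \<comment> \<open>A subgradient at a point with an infinite value is not excluded beforehand;
      any positive slope serves there.\<close>
    case PInf then show ?thesis using that[of 1] by simp
  next
    case MInf then show ?thesis using f(1) by (simp add: above_minfty_def)
  qed
  let ?S = "closed_segment a u"
  have lsc: "lsc_fun (\<lambda>x. f x + ereal (- us x))"
    by (intro lsc_fun_add_continuous f continuous_intros)
  have "above_minfty (\<lambda>x. f x + ereal (- us x))"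
    using f(1) by (auto simp: above_minfty_def)
  then obtain \<delta> m where \<delta>: "\<delta> > 0"
    and low: "\<And>y. infdist y ?S \<le> \<delta> \<Longrightarrow> ereal m \<le> f y + ereal (- us y)"
    by (rule lsc_fun_bounded_below_near_compact[OF lsc _ compact_segment]) auto
  obtain w and ys :: "nat \<Rightarrow> 'a dual" and y :: "nat \<Rightarrow> 'a" and L
    where "infdist w ?S \<le> \<delta>"
    and w: "f w + ereal (K * dist w u - us w) \<le> f a + ereal (2 * K * dist a u - us a)"
    and y: "\<And>n. ys n \<in> D f (y n)" "y \<longlonglongrightarrow> w" and "(\<lambda>n. f (y n)) \<longlonglongrightarrow> f w"
    and L: "(\<lambda>n. ys n (u - y n)) \<longlonglongrightarrow> L" "us (u - w) + K * dist w u \<le> L"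
    by (rule subgradients_towards_point[where z = u, OF D f a K(1) \<delta> low])
      (assumption, rule that)
  \<comment> \<open>For \<open>w = u\<close> the value estimate would contradict the choice of
    \<open>K\<close>.\<close>
  have "w \<noteq> u"
    using w K(2) by (cases "f u") (auto simp: \<alpha>)
  \<comment> \<open>Monotonicity between \<open>u\<close> and \<open>y n\<close> passes to the limit
    as \<open>L \<le> us (u - w)\<close>, against the lower bound on \<open>L\<close>.\<close>
  have "(\<lambda>n. us (u - y n)) \<longlonglongrightarrow> us (u - w)"
    by (intro tendsto_intros y)
  moreover have "ys n (u - y n) \<le> us (u - y n)" for n
  proof -
    have "(us - ys n) (u - y n) \<ge> 0"
      using mono us y(1)[of n] unfolding monotone_operator_def operator_graph_def by blast
    then show ?thesis by (simp add: blinfun.diff_left)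
  qed
  ultimately have "L \<le> us (u - w)"
    by (intro LIMSEQ_le[OF L(1)]) auto
  then have "K * dist w u \<le> 0" using L(2) by simp
  then show False using K(1) \<open>w \<noteq> u\<close> by (simp add: mult_le_0_iff)
qed

theorem theorem2:
  fixes D :: "('a::banach \<Rightarrow> ereal) \<Rightarrow> 'a \<Rightarrow> 'a dual set"
    and f :: "'a \<Rightarrow> ereal"
  assumes "feasible_subdifferential D"
    and "above_minfty f"
    and "proper_fun f"
    and "lsc_fun f"
    and "monotone_operator (D f)"
  shows "econvex_on UNIV f"
  unfolding econvex_on_def
proof (intro conjI ballI allI impI)
  fix a b :: 'a and s t :: real
  assume st: "0 \<le> s" "0 \<le> t" "s + t = 1"
  define z where "z = s *\<^sub>R a + t *\<^sub>R b"
  have not_MInf: "f x \<noteq> - \<infinity>" for x using assms(2) by (simp add: above_minfty_def)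
  \<comment> \<open>A zero weight is harmless as \<open>0 * \<infinity> = 0\<close>, and with
    positive weights an infinite value makes the right-hand side infinite. Only finite values at
    both ends need an argument.\<close>
  consider "s = 0" | "t = 0" | "s > 0" "t > 0" "f a = \<infinity> \<or> f b = \<infinity>"
    | \<alpha> \<beta> where "f a = ereal \<alpha>" "f b = ereal \<beta>"
    using st not_MInf[of a] not_MInf[of b] by (cases "f a"; cases "f b"; fastforce)
  then have "f z \<le> ereal s * f a + ereal t * f b"
  proof cases
    case 3
    then have "ereal s * f a + ereal t * f b = \<infinity>"
      using not_MInf[of a] not_MInf[of b] by (cases "f a"; cases "f b") auto
    then show ?thesis by (simp only: ereal_less_eq(1))
  next
    case 4
    define r where "r = s * \<alpha> + t * \<beta>"
    have "f z \<le> ereal r"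
    proof (rule ccontr)
      assume "\<not> ?thesis"
      then have "\<forall>\<^sub>F w in nhds z. ereal r < f w" by (intro lsc_funD[OF assms(4)]) simp
      then obtain \<rho> where \<rho>: "\<rho> > 0" "\<And>w. dist w z < \<rho> \<Longrightarrow> ereal r < f w"
        unfolding eventually_nhds_metric by blast
      let ?S = "closed_segment a z"
      obtain \<delta> m where \<delta>: "\<delta> > 0" and low: "\<And>y. infdist y ?S \<le> \<delta> \<Longrightarrow> ereal m \<le> f y"
        by (rule lsc_fun_bounded_below_near_compact[OF assms(4,2) compact_segment]) auto
      \<comment> \<open>Points at distance at least \<rho> from \<open>z\<close> then satisfy
        \<open>m + K * dist w z > r\<close>; for closer points \<open>f w > r\<close> holds by the
        choice of \<rho>.\<close>
      define K where "K = (\<bar>r - m\<bar> + 1) / \<rho>"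
      have K: "K > 0" "m + K * \<rho> > r" using \<rho> by (auto simp: K_def)
      have a: "a \<in> edom f" by (simp add: edom_def 4)
      have low0: "ereal m \<le> f y + ereal (- blinfun_apply 0 y)" if "infdist y ?S \<le> \<delta>" for y
        using low[OF that] by simp
      obtain w and ys :: "nat \<Rightarrow> 'a dual" and y :: "nat \<Rightarrow> 'a" and L
        where w: "infdist w ?S \<le> \<delta>"
          "f w + ereal (K * dist w z - blinfun_apply 0 w)
            \<le> f a + ereal (2 * K * dist a z - blinfun_apply 0 a)"
        and y: "\<And>n. ys n \<in> D f (y n)" "y \<longlonglongrightarrow> w" "(\<lambda>n. f (y n)) \<longlonglongrightarrow> f w"
        and L: "(\<lambda>n. ys n (z - y n)) \<longlonglongrightarrow> L" "blinfun_apply 0 (z - w) + K * dist w z \<le> L"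
        by (rule subgradients_towards_point[where z = z, OF assms(1,2,4) a K(1) \<delta> low0])
          (assumption, rule that)
      have L_ge: "K * dist w z \<le> L" using L(2) by simp
      have "f w \<noteq> \<infinity>" using w(2) by (auto simp: 4)
      then obtain \<gamma> where \<gamma>: "f w = ereal \<gamma>" using not_MInf[of w] by (cases "f w") auto
      have "r < \<gamma> + L"
      proof (cases "dist w z < \<rho>")
        case True
        moreover have "0 \<le> K * dist w z" using K by simp
        ultimately show ?thesis using \<rho>(2)[of w] \<gamma> L_ge by simp
      next
        case False
        then have "K * \<rho> \<le> K * dist w z" using K by simp
        moreover have "m \<le> \<gamma>" using low[OF w(1)] \<gamma> by simp
        ultimately show ?thesis using K(2) L_ge by simp
      qed
      \<comment> \<open>The affine minorant given by \<open>ys n\<close> lies below \<open>f\<close>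
        at \<open>a\<close> and \<open>b\<close>, and its value at \<open>z\<close> is the weighted
        mean of its values there.\<close>
      have "f (y n) + ereal (ys n (z - y n)) \<le> ereal r" for n
      proof -
        have le: "f (y n) + ereal (ys n (x - y n)) \<le> f x" for x
          by (rule monotone_subdifferential_affine_minorant[OF assms(1,2,4,5) y(1)])
        \<comment> \<open>The minorant inequality at \<open>a\<close>, where \<open>f\<close> is
          finite, rules out an infinite \<open>f (y n)\<close>.\<close>
        obtain \<eta> where \<eta>: "f (y n) = ereal \<eta>"
          using le[of a] not_MInf[of "y n"] by (cases "f (y n)") (auto simp: 4)
        have "z - y n = s *\<^sub>R (a - y n) + t *\<^sub>R (b - y n)"
          using st(3) by (simp add: z_def algebra_simps flip: scaleR_add_left)
        then have "ys n (z - y n) = s * ys n (a - y n) + t * ys n (b - y n)"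
          by (simp only: blinfun.add_right blinfun.scaleR_right real_scaleR_def)
        moreover have "\<eta> = s * \<eta> + t * \<eta>"
          using st(3) by (simp flip: distrib_right)
        ultimately have "\<eta> + ys n (z - y n)
            = s * (\<eta> + ys n (a - y n)) + t * (\<eta> + ys n (b - y n))"
          by (simp only: distrib_left)
        also have "\<dots> \<le> r"
          unfolding r_def using st le[of a] le[of b] by (intro add_mono mult_left_mono) (auto simp: 4 \<eta>)
        finally show ?thesis by (simp add: \<eta>)
      qed
      moreover have "(\<lambda>n. f (y n) + ereal (ys n (z - y n))) \<longlonglongrightarrow> ereal \<gamma> + ereal L"
        using y(3) L(1) by (intro tendsto_add_ereal) (auto simp: \<gamma>)
      ultimately have "ereal \<gamma> + ereal L \<le> ereal r" by (intro LIMSEQ_le_const2) auto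
      then show False using \<open>r < \<gamma> + L\<close> by simp
    qed
    then show ?thesis by (simp add: 4 r_def)
  qed (use st in \<open>auto simp: z_def zero_ereal_def[symmetric] one_ereal_def[symmetric]\<close>)
  then show "f (s *\<^sub>R a + t *\<^sub>R b) \<le> ereal s * f a + ereal t * f b"
    by (simp add: z_def)
qed simp

end
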